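(* Let $G$ be a graph and let $\ell\ge 0$ be an integer. For any edge $e$ of $G$, \[ -2\le Z_{(\ell)}(G)-Z_{(\ell)}(G-e)\le 2. \] Moreover, these bounds are tight for every $\ell\ge 1$: for every $\ell\ge1$ there exist a graph $G$ and an edge $e$ of $G$ with $Z_{(\ell)}(G)-Z_{(\ell)}(G-e)=-2$, and there exist a graph $G$ and an edge $e$ of $G$ with $Z_{(\ell)}(G)-Z_{(\ell)}(G-e)=2$.
   Context: All graphs are finite, simple and undirected. Let $G$ be a graph, $S\subseteq V(G)$ a set of initially blue vertices (all other vertices white), and $L\subseteq V(G)$ a set of leaks. The leaky color change rule: a blue vertex $b\notin L$ which has exactly one white neighbor $w$ may force $w$ to become blue. $S$ is an $\ell$-leaky forcing set if for every choice of a set $L$ of $\ell$ leaks, repeated application of the rule eventually turns all vertices blue (if $\ell>|V(G)|$, this is read with $L=V(G)$). $Z_{(\ell)}(G)$ is the minimum size of an $\ell$-leaky forcing set of $G$; for $\ell=0$ it is the zero forcing number $Z(G)$. $G-e$ denotes the graph with vertex set $V(G)$ and edge set $E(G)\setminus\{e\}$. *)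

theory Defs
  imports "Graph_Theory.Pair_Digraph"
begin

text \<open>
  A finite simple undirected graph is a \<open>pair_graph\<close>: a finite, loop-free digraph whose arc
  relation is symmetric. An undirected edge is the two-element set of its endpoints and corresponds
  to the two arcs \<open>(u, v)\<close> and \<open>(v, u)\<close>.
\<close>

definition undirected_edges :: "'a pair_pre_digraph \<Rightarrow> 'a set set" where
  "undirected_edges G = {{u, v} | u v. (u, v) \<in> parcs G}"

definition delete_edge :: "'a pair_pre_digraph \<Rightarrow> 'a set \<Rightarrow> 'a pair_pre_digraph" where
  "delete_edge G e = G \<lparr>parcs := {(u, v) \<in> parcs G. {u, v} \<noteq> e}\<rparr>"

lemma pair_graph_delete_edge:
  assumes "pair_graph G"
  shows "pair_graph (delete_edge G e)"
proof -
  interpret pair_graph G by (rule assms)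
  have fin: "finite {(u, v) \<in> parcs G. {u, v} \<noteq> e}"
    by (rule finite_subset[OF _ pair_finite_arcs]) auto
  have "symmetric (with_proj (delete_edge G e))"
    unfolding symmetric_def delete_edge_def
    by (auto intro!: symI simp: insert_commute arcs_symmetric)
  then show ?thesis
    using fin by unfold_locales
      (auto simp: delete_edge_def pair_finite_verts intro: arc_fst_in_verts arc_snd_in_verts
        dest: no_loops in_arcsD1 in_arcsD2)
qed

lemma undirected_edges_delete_edge:
  "undirected_edges (delete_edge G e) = undirected_edges G - {e}"
  by (auto simp: undirected_edges_def delete_edge_def)

text \<open>One application of the rule takes the set \<open>B\<close> of blue vertices to \<open>insert w B\<close>.\<close>

inductive leaky_force :: "'a pair_pre_digraph \<Rightarrow> 'a set \<Rightarrow> 'a set \<Rightarrow> 'a set \<Rightarrow> bool"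
  for G :: "'a pair_pre_digraph" and L :: "'a set" where
  "\<lbrakk>b \<in> B; b \<notin> L; {x \<in> pverts G - B. (b, x) \<in> parcs G} = {w}\<rbrakk>
    \<Longrightarrow> leaky_force G L B (insert w B)"

text \<open>With \<open>l\<close> leaks requested and fewer than \<open>l\<close> vertices, all vertices leak; hence \<open>min\<close>.\<close>

definition leaky_forcing_set :: "nat \<Rightarrow> 'a pair_pre_digraph \<Rightarrow> 'a set \<Rightarrow> bool" where
  "leaky_forcing_set l G S \<longleftrightarrow> S \<subseteq> pverts G \<and>
     (\<forall>L. L \<subseteq> pverts G \<and> card L = min l (card (pverts G)) \<longrightarrow>
       (leaky_force G L)\<^sup>*\<^sup>* S (pverts G))"

definition leaky_forcing_number :: "nat \<Rightarrow> 'a pair_pre_digraph \<Rightarrow> nat" where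
  "leaky_forcing_number l G = (LEAST n. \<exists>S. leaky_forcing_set l G S \<and> card S = n)"

lemma leaky_forcing_set_pverts: "leaky_forcing_set l G (pverts G)"
  by (simp add: leaky_forcing_set_def)

lemma leaky_forcing_number_attained:
  "\<exists>S. leaky_forcing_set l G S \<and> card S = leaky_forcing_number l G"
  unfolding leaky_forcing_number_def
  by (rule LeastI_ex) (use leaky_forcing_set_pverts in blast)

end

theory Submission
  imports Defs
begin

text \<open>
  The proof never follows a forcing process. A set \<open>X\<close> of white vertices can only be entered by
  a blue vertex with exactly one neighbour in \<open>X\<close>, a lone neighbour of \<open>X\<close>. If \<open>X\<close> has at most
  \<open>l\<close> lone neighbours, making all of them leaks keeps \<open>X\<close> white forever; call a nonempty such set a
  fort. Conversely, a process that gets stuck leaves a white set all of whose lone neighbours are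
  leaks, hence a fort. So \<open>S\<close> is an \<open>l\<close>-leaky forcing set iff it meets every fort
  (\<open>leaky_forcing_set_iff_meets_forts\<close>).

  The lone neighbours of a set that avoids both endpoints of \<open>e\<close> are the same in \<open>G\<close> and in
  \<open>G - e\<close>. Adding the endpoints to a forcing set of either graph therefore yields one of the other,
  which is the bound \<open>2\<close> in both directions.

  Both examples exploit that a vertex of degree at most \<open>l\<close> is itself a fort and so lies in
  every forcing set.

    \<^item> Two adjacent centres with \<open>l\<close> leaves each have degree \<open>l + 1\<close>, and the leaves alone are a
      forcing set. Without the edge between them both centres have degree \<open>l\<close>, and every vertex has
      to be chosen.

    \<^item> For the opposite direction a graph is built in which the vertices of degree at most \<open>l\<close>
      meet every fort of \<open>G - e\<close>, while in \<open>G\<close> there are two further, disjoint forts among the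
      remaining vertices. An endpoint of \<open>e\<close> outside such a set \<open>X\<close> is a lone neighbour of \<open>X\<close> in
      \<open>G - e\<close>, but has a second neighbour in \<open>X\<close> as soon as \<open>e\<close> is present; this loss of one lone
      neighbour makes \<open>X\<close> a fort.
\<close>

section \<open>Forts\<close>

definition lone_neighbours :: "'a pair_pre_digraph \<Rightarrow> 'a set \<Rightarrow> 'a set" where
  "lone_neighbours G X = {b \<in> pverts G - X. \<exists>!w. w \<in> X \<and> (b, w) \<in> parcs G}"

lemma finite_lone_neighbours: "finite (pverts G) \<Longrightarrow> finite (lone_neighbours G X)"
  by (simp add: lone_neighbours_def)

text \<open>
  A force from outside \<open>X\<close> into \<open>X\<close> is performed by a lone neighbour of \<open>X\<close>: the white neighbours of
  the forcing vertex include all its neighbours in \<open>X\<close>.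
\<close>

lemma forcing_avoids_guarded_set:
  assumes "(leaky_force G L)\<^sup>*\<^sup>* S T" and "S \<subseteq> pverts G" and "S \<inter> X = {}"
    and "X \<subseteq> pverts G" and "lone_neighbours G X \<subseteq> L"
  shows "T \<subseteq> pverts G \<and> T \<inter> X = {}"
  using assms(1)
proof (induction rule: rtranclp_induct)
  case base
  then show ?case using assms by simp
next
  case (step B C)
  from step.hyps(2) obtain b w where b: "b \<in> B" "b \<notin> L" "C = insert w B"
    and w: "{x \<in> pverts G - B. (b, x) \<in> parcs G} = {w}"
    by (cases rule: leaky_force.cases) auto
  have "w \<notin> X"
  proof
    assume "w \<in> X"
    moreover have "(b, w) \<in> parcs G" using w by blast
    moreover have "x = w" if "x \<in> X" "(b, x) \<in> parcs G" for x
      using that w step.IH assms(4) by blast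
    ultimately have "b \<in> lone_neighbours G X"
      using b(1) step.IH unfolding lone_neighbours_def by auto
    then show False using b assms(5) by blast
  qed
  moreover have "w \<in> pverts G" using w by blast
  ultimately show ?case using step.IH b(3) by simp
qed

text \<open>
  As long as some vertex is white, the hypothesis applied to the set of all white vertices supplies a
  lone neighbour of it that is no leak, and this vertex can force.
\<close>

lemma forcing_completes:
  assumes "finite (pverts G)" and "S \<subseteq> pverts G"
    and "\<And>X. X \<subseteq> pverts G - S \<Longrightarrow> X \<noteq> {} \<Longrightarrow> \<not> lone_neighbours G X \<subseteq> L"
  shows "(leaky_force G L)\<^sup>*\<^sup>* S (pverts G)"
  using assms(2,3)
proof (induction "card (pverts G - S)" arbitrary: S rule: less_induct)
  case less
  show ?case
  proof (cases "S = pverts G")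
    case False
    let ?X = "pverts G - S"
    have "?X \<noteq> {}" using False less.prems(1) by blast
    then obtain b where b: "b \<in> lone_neighbours G ?X" "b \<notin> L"
      using less.prems(2)[of ?X] by blast
    then obtain w where w: "{x \<in> pverts G - S. (b, x) \<in> parcs G} = {w}" and "b \<in> S"
      unfolding lone_neighbours_def by blast
    then have step: "leaky_force G L S (insert w S)"
      using b by (auto intro: leaky_force.intros)
    have "w \<in> ?X" using w by blast
    then have "pverts G - insert w S \<subset> ?X" by blast
    then have "card (pverts G - insert w S) < card ?X"
      using assms(1) by (auto intro: psubset_card_mono)
    then have "(leaky_force G L)\<^sup>*\<^sup>* (insert w S) (pverts G)"
    proof (rule less.hyps)
      show "insert w S \<subseteq> pverts G" using \<open>w \<in> ?X\<close> less.prems(1) by blast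
      show "\<not> lone_neighbours G X \<subseteq> L" if "X \<subseteq> pverts G - insert w S" "X \<noteq> {}" for X
        using less.prems(2)[of X] that by blast
    qed
    with step show ?thesis by (rule converse_rtranclp_into_rtranclp)
  qed simp
qed

text \<open>
  The lone neighbours of a fort can be enlarged to a leak set of the prescribed size
  \<open>min l (card (pverts G))\<close>, because they number at most \<open>l\<close> and are vertices of \<open>G\<close>.
\<close>

theorem leaky_forcing_set_iff_meets_forts:
  assumes fin: "finite (pverts G)"
  shows "leaky_forcing_set l G S \<longleftrightarrow> S \<subseteq> pverts G \<and>
    (\<forall>X. X \<subseteq> pverts G \<and> X \<noteq> {} \<and> card (lone_neighbours G X) \<le> l \<longrightarrow> S \<inter> X \<noteq> {})"
    (is "_ \<longleftrightarrow> _ \<and> ?meets")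
proof (intro iffI conjI)
  assume S: "leaky_forcing_set l G S"
  then show "S \<subseteq> pverts G" by (simp add: leaky_forcing_set_def)
  show ?meets
  proof (intro allI impI notI, elim conjE)
    fix X assume X: "X \<subseteq> pverts G" "X \<noteq> {}" "card (lone_neighbours G X) \<le> l" "S \<inter> X = {}"
    have "lone_neighbours G X \<subseteq> pverts G" by (auto simp: lone_neighbours_def)
    moreover from this have "card (lone_neighbours G X) \<le> min l (card (pverts G))"
      using X(3) fin by (simp add: card_mono)
    ultimately obtain L where L: "lone_neighbours G X \<subseteq> L" "L \<subseteq> pverts G"
      "card L = min l (card (pverts G))"
      using exists_subset_between[of "lone_neighbours G X" "min l (card (pverts G))" "pverts G"]
        fin by auto
    then have "(leaky_force G L)\<^sup>*\<^sup>* S (pverts G)"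
      using S by (simp add: leaky_forcing_set_def)
    then show False
      using forcing_avoids_guarded_set[of G L S "pverts G" X] L(1) X \<open>S \<subseteq> pverts G\<close> by blast
  qed
next
  assume S: "S \<subseteq> pverts G \<and> ?meets"
  have "(leaky_force G L)\<^sup>*\<^sup>* S (pverts G)"
    if L: "L \<subseteq> pverts G" "card L = min l (card (pverts G))" for L
  proof (rule forcing_completes[OF fin])
    fix X assume X: "X \<subseteq> pverts G - S" "X \<noteq> {}"
    then have "X \<subseteq> pverts G" "S \<inter> X = {}" by auto
    then have "l < card (lone_neighbours G X)" using S X(2) by (meson not_le)
    moreover have "finite L" using L(1) fin by (rule finite_subset)
    ultimately show "\<not> lone_neighbours G X \<subseteq> L"
      using L(2) card_mono[of L "lone_neighbours G X"] by auto
  qed (use S in blast)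
  with S show "leaky_forcing_set l G S" by (simp add: leaky_forcing_set_def)
qed

lemma leaky_forcing_number_le: "leaky_forcing_set l G S \<Longrightarrow> leaky_forcing_number l G \<le> card S"
  unfolding leaky_forcing_number_def by (rule Least_le) blast

text \<open>
  The lone neighbours of a singleton are the neighbours of its element. They are bounded by a
  superset \<open>N\<close>, as exact neighbourhoods are awkward to write down in the examples.
\<close>

lemma low_degree_in_leaky_forcing_set:
  assumes "pair_graph G" and "leaky_forcing_set l G S" and "v \<in> pverts G"
    and "{b. (b, v) \<in> parcs G} \<subseteq> N" and "finite N" and "card N \<le> l"
  shows "v \<in> S"
proof -
  interpret pair_graph G by (rule assms(1))
  have "lone_neighbours G {v} \<subseteq> N" using assms(4) by (auto simp: lone_neighbours_def)
  then have "card (lone_neighbours G {v}) \<le> l"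
    using assms(5,6) by (meson card_mono le_trans)
  then show ?thesis
    using assms(2,3) leaky_forcing_set_iff_meets_forts[OF pair_finite_verts, of l S] by blast
qed

section \<open>Changing one edge\<close>

text \<open>
  A set that avoids \<open>u\<close> and \<open>v\<close> has the same lone neighbours in both graphs, so the forts that
  \<open>S \<union> {u, v}\<close> does not meet through \<open>u\<close> or \<open>v\<close> are met by \<open>S\<close>. Stated for two graphs
  \<open>G\<close> and \<open>H\<close>, it serves for deletion and insertion of an edge alike.
\<close>

lemma leaky_forcing_set_edge_change:
  assumes "finite (pverts G)" and "pverts H = pverts G" and "u \<in> pverts G" "v \<in> pverts G"
    and arcs: "\<And>x y. y \<noteq> u \<Longrightarrow> y \<noteq> v \<Longrightarrow> (x, y) \<in> parcs H \<longleftrightarrow> (x, y) \<in> parcs G"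
    and S: "leaky_forcing_set l G S"
  shows "leaky_forcing_set l H (S \<union> {u, v})"
proof -
  have eq: "lone_neighbours H X = lone_neighbours G X" if "u \<notin> X" "v \<notin> X" for X
  proof -
    have "w \<in> X \<and> (b, w) \<in> parcs H \<longleftrightarrow> w \<in> X \<and> (b, w) \<in> parcs G" for b w
      using that arcs[of w b] by blast
    then show ?thesis unfolding lone_neighbours_def assms(2) by simp
  qed
  have meets: "S \<inter> X \<noteq> {}"
    if "X \<subseteq> pverts G" "X \<noteq> {}" "card (lone_neighbours G X) \<le> l" for X
    using that S unfolding leaky_forcing_set_iff_meets_forts[OF assms(1)] by simp
  have "(S \<union> {u, v}) \<inter> X \<noteq> {}"
    if X: "X \<subseteq> pverts G" "X \<noteq> {}" "card (lone_neighbours H X) \<le> l" for X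
  proof (cases "u \<in> X \<or> v \<in> X")
    case False
    then show ?thesis using meets[of X] X eq[of X] by auto
  qed auto
  moreover have "finite (pverts H)" "S \<subseteq> pverts G"
    using S assms(1,2) by (simp_all add: leaky_forcing_set_def)
  ultimately show ?thesis
    using assms(2-4) by (simp add: leaky_forcing_set_iff_meets_forts)
qed

lemma leaky_forcing_number_edge_change:
  assumes "finite (pverts G)" and "pverts H = pverts G" and "u \<in> pverts G" "v \<in> pverts G"
    and "\<And>x y. y \<noteq> u \<Longrightarrow> y \<noteq> v \<Longrightarrow> (x, y) \<in> parcs H \<longleftrightarrow> (x, y) \<in> parcs G"
  shows "leaky_forcing_number l H \<le> leaky_forcing_number l G + 2"
proof -
  obtain S where S: "leaky_forcing_set l G S" "card S = leaky_forcing_number l G"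
    using leaky_forcing_number_attained by blast
  have "leaky_forcing_number l H \<le> card (S \<union> {u, v})"
    by (intro leaky_forcing_number_le leaky_forcing_set_edge_change[OF assms S(1)])
  also have "\<dots> \<le> card S + card {u, v}" by (rule card_Un_le)
  also have "card {u, v} \<le> 2" by (simp add: card_insert_if)
  finally show ?thesis using S(2) by simp
qed

lemma pverts_delete_edge [simp]: "pverts (delete_edge G e) = pverts G"
  by (simp add: delete_edge_def)

lemma parcs_delete_edge [simp]:
  "(x, y) \<in> parcs (delete_edge G e) \<longleftrightarrow> (x, y) \<in> parcs G \<and> {x, y} \<noteq> e"
  by (simp add: delete_edge_def)

proposition leaky_forcing_number_delete_edge:
  assumes "pair_graph G" and "e \<in> undirected_edges G"
  shows "leaky_forcing_number l (delete_edge G e) \<le> leaky_forcing_number l G + 2"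
    and "leaky_forcing_number l G \<le> leaky_forcing_number l (delete_edge G e) + 2"
proof -
  interpret pair_graph G by (rule assms(1))
  obtain u v where e: "e = {u, v}" "(u, v) \<in> parcs G"
    using assms(2) by (auto simp: undirected_edges_def)
  then have ends: "u \<in> pverts G" "v \<in> pverts G" by (auto dest: in_arcsD1 in_arcsD2)
  have arcs: "(x, y) \<in> parcs (delete_edge G e) \<longleftrightarrow> (x, y) \<in> parcs G"
    if "y \<noteq> u" "y \<noteq> v" for x y
    using that e(1) by (auto simp: doubleton_eq_iff)
  show "leaky_forcing_number l (delete_edge G e) \<le> leaky_forcing_number l G + 2"
    by (rule leaky_forcing_number_edge_change[where u = u and v = v])
      (use pair_finite_verts ends arcs in simp_all)
  show "leaky_forcing_number l G \<le> leaky_forcing_number l (delete_edge G e) + 2"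
    by (rule leaky_forcing_number_edge_change[where u = u and v = v])
      (use pair_finite_verts ends arcs in simp_all)
qed

section \<open>Graphs and progressions of natural numbers\<close>

definition graph_on :: "'a set \<Rightarrow> ('a \<Rightarrow> 'a \<Rightarrow> bool) \<Rightarrow> 'a pair_pre_digraph" where
  "graph_on V A = \<lparr>pverts = V, parcs = {(x, y). x \<in> V \<and> y \<in> V \<and> x \<noteq> y \<and> (A x y \<or> A y x)}\<rparr>"

lemma pverts_graph_on [simp]: "pverts (graph_on V A) = V"
  by (simp add: graph_on_def)

lemma parcs_graph_on [simp]:
  "(x, y) \<in> parcs (graph_on V A) \<longleftrightarrow> x \<in> V \<and> y \<in> V \<and> x \<noteq> y \<and> (A x y \<or> A y x)"
  by (simp add: graph_on_def)

lemma pair_graph_graph_on: "finite V \<Longrightarrow> pair_graph (graph_on V A)"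
proof -
  assume fin: "finite V"
  have "finite (parcs (graph_on V A))"
    by (rule finite_subset[of _ "V \<times> V"]) (use fin in \<open>auto simp: graph_on_def\<close>)
  moreover have "symmetric (with_proj (graph_on V A))"
    unfolding symmetric_def by (auto intro!: symI)
  ultimately show ?thesis
    using fin by unfold_locales auto
qed

definition progression :: "nat \<Rightarrow> nat \<Rightarrow> nat \<Rightarrow> nat set" where
  "progression d c m = (\<lambda>j. c + d * j) ` {..<m}"

lemma progression_iff:
  assumes "0 < d"
  shows "b \<in> progression d c m \<longleftrightarrow> c \<le> b \<and> b < c + d * m \<and> b mod d = c mod d"
proof
  assume "b \<in> progression d c m"
  then show "c \<le> b \<and> b < c + d * m \<and> b mod d = c mod d"
    using assms by (auto simp: progression_def)
next
  assume b: "c \<le> b \<and> b < c + d * m \<and> b mod d = c mod d"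
  then have "d dvd b - c" by (metis mod_eq_dvd_iff_nat)
  then obtain j where "b - c = d * j" ..
  with b have "b = c + d * j" by linarith
  moreover from this b assms have "j < m" by simp
  ultimately show "b \<in> progression d c m" by (auto simp: progression_def)
qed

lemma card_progression: "0 < d \<Longrightarrow> card (progression d c m) = m"
  by (auto simp: progression_def card_image inj_on_def)

lemma finite_progression: "finite (progression d c m)"
  by (simp add: progression_def)

lemma lone_neighboursI:
  assumes "b \<in> pverts G" and "b \<notin> X" and "w \<in> X" and "(b, w) \<in> parcs G"
    and "\<And>x. x \<in> X \<Longrightarrow> (b, x) \<in> parcs G \<Longrightarrow> x = w"
  shows "b \<in> lone_neighbours G X"
  using assms unfolding lone_neighbours_def by auto

lemma less_card_lone_neighboursI:
  assumes "finite (pverts G)" and "F \<subseteq> lone_neighbours G X" and "l < card F"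
  shows "l < card (lone_neighbours G X)"
  using assms(3) card_mono[OF finite_lone_neighbours[OF assms(1)] assms(2)] by (rule less_le_trans)

section \<open>The double star: deleting an edge costs two vertices\<close>

text \<open>
  Two adjacent centres \<open>0\<close> and \<open>1\<close>, each carrying \<open>l\<close> of the leaves \<open>2, ..., 2 * l + 1\<close>
  according to parity.
\<close>

definition double_star :: "nat \<Rightarrow> nat pair_pre_digraph" where
  "double_star l = graph_on {..<2 * l + 2} (\<lambda>x y. (x = 0 \<and> y = 1) \<or> (2 \<le> x \<and> y = x mod 2))"

lemma edge_in_double_star: "{0, 1} \<in> undirected_edges (double_star l)"
proof -
  have "(0, 1) \<in> parcs (double_star l)" by (simp add: double_star_def)
  then show ?thesis unfolding undirected_edges_def by blast
qed

text \<open>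
  A fort that avoids the leaves would consist of centres. One centre alone has its \<open>l\<close> leaves
  and the other centre as lone neighbours; both centres together have all \<open>2 * l\<close> leaves, which
  exceeds \<open>l\<close> only for positive \<open>l\<close>.
\<close>

lemma leaky_forcing_number_double_star_le:
  assumes "1 \<le> l"
  shows "leaky_forcing_number l (double_star l) \<le> 2 * l"
proof -
  let ?G = "double_star l" and ?D = "{2..<2 * l + 2}"
  have "l < card (lone_neighbours ?G X)"
    if X: "X \<subseteq> {..<2 * l + 2}" "?D \<inter> X = {}" "X \<noteq> {}" for X
  proof -
    have "x \<in> {0, 1}" if "x \<in> X" for x
    proof -
      have "\<not> 2 \<le> x" using that X(1,2) by fastforce
      then have "x = 0 \<or> x = 1" by linarith
      then show ?thesis by simp
    qed
    then have "X \<subseteq> {0, 1}" by blast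
    then consider "X = {0, 1}" | "X = {0}" | "X = {1}" using X(3) by blast
    then show ?thesis
    proof cases
      case 1
      have "b \<in> lone_neighbours ?G X" if "b \<in> ?D" for b
        using that 1
        by (intro lone_neighboursI[where w = "b mod 2"]) (auto simp: double_star_def)
      then have "?D \<subseteq> lone_neighbours ?G X" by blast
      then show ?thesis
        by (rule less_card_lone_neighboursI[rotated]) (use assms in \<open>auto simp: double_star_def\<close>)
    next
      case 2
      have "b \<in> lone_neighbours ?G X" if "b \<in> insert 1 (progression 2 2 l)" for b
        using that 2
        by (intro lone_neighboursI[where w = "0"]) (auto simp: double_star_def progression_def)
      then have "insert 1 (progression 2 2 l) \<subseteq> lone_neighbours ?G X" by blast
      then show ?thesis
        by (rule less_card_lone_neighboursI[rotated])
          (auto simp: double_star_def progression_iff card_progression finite_progression)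
    next
      case 3
      have "b \<in> lone_neighbours ?G X" if "b \<in> insert 0 (progression 2 3 l)" for b
        using that 3
        by (intro lone_neighboursI[where w = "1"]) (auto simp: double_star_def progression_def)
      then have "insert 0 (progression 2 3 l) \<subseteq> lone_neighbours ?G X" by blast
      then show ?thesis
        by (rule less_card_lone_neighboursI[rotated])
          (auto simp: double_star_def progression_iff card_progression finite_progression)
    qed
  qed
  then have "leaky_forcing_set l ?G ?D"
    by (subst leaky_forcing_set_iff_meets_forts) (auto simp: double_star_def not_le[symmetric])
  from leaky_forcing_number_le[OF this] show ?thesis by simp
qed

text \<open>After the deletion the centres have degree \<open>l\<close>, and every vertex is a fort by itself.\<close>

lemma leaky_forcing_number_split_double_star_ge:
  assumes "1 \<le> l"
  shows "2 * l + 2 \<le> leaky_forcing_number l (delete_edge (double_star l) {0, 1})"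
proof -
  let ?H = "delete_edge (double_star l) {0, 1}"
  have graph: "pair_graph ?H"
    unfolding double_star_def by (intro pair_graph_delete_edge pair_graph_graph_on) simp
  obtain S where S: "leaky_forcing_set l ?H S" "card S = leaky_forcing_number l ?H"
    using leaky_forcing_number_attained by blast
  have "v \<in> S" if "v < 2 * l + 2" for v
  proof -
    have v: "v \<in> pverts ?H" using that by (simp add: double_star_def)
    consider "v = 0" | "v = 1" | "2 \<le> v" by linarith
    then show ?thesis
    proof cases
      case 1
      have "{b. (b, v) \<in> parcs ?H} \<subseteq> progression 2 2 l"
        using 1 by (auto simp: double_star_def progression_iff)
      then show ?thesis
        by (rule low_degree_in_leaky_forcing_set[OF graph S(1) v])
          (simp_all add: card_progression finite_progression)
    next
      case 2
      have "{b. (b, v) \<in> parcs ?H} \<subseteq> progression 2 3 l"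
        using 2 by (auto simp: double_star_def progression_iff) presburger+
      then show ?thesis
        by (rule low_degree_in_leaky_forcing_set[OF graph S(1) v])
          (simp_all add: card_progression finite_progression)
    next
      case 3
      have "{b. (b, v) \<in> parcs ?H} \<subseteq> {v mod 2}"
        using 3 by (auto simp: double_star_def)
      then show ?thesis
        by (rule low_degree_in_leaky_forcing_set[OF graph S(1) v]) (use assms in auto)
    qed
  qed
  moreover have "finite S"
    using S(1) by (auto simp: leaky_forcing_set_def double_star_def intro: finite_subset)
  ultimately have "card {..<2 * l + 2} \<le> card S" by (intro card_mono) auto
  then show ?thesis using S(2) by simp
qed

section \<open>A square with tufts: deleting an edge saves two vertices\<close>

text \<open>
  The core is the square \<open>0, 1, 2, 3\<close>, and the outer vertices are grouped by their residue modulo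
  \<open>4\<close>: \<open>l\<close> leaves at \<open>0\<close>, \<open>l\<close> leaves at \<open>1\<close>, \<open>l - 1\<close> common neighbours of \<open>0\<close> and \<open>2\<close>, and
  \<open>l - 1\<close> common neighbours of \<open>1\<close> and \<open>3\<close>. For \<open>l = 1\<close> this is a four-cycle with pendant vertices
  at two adjacent corners; without the edge \<open>{0, 1}\<close> it is a path on six vertices, whose two ends
  tolerate one leak because the forcing from one end takes over where a leak stops the other. For larger \<open>l\<close> the additional
  \<open>l - 1\<close> copies in every group raise by at least \<open>l - 1\<close> the number of lone neighbours of every
  nonempty subset of the core, and by exactly \<open>l - 1\<close> that of the pairs \<open>{0, 2}\<close> and \<open>{1, 3}\<close>,
  since a common neighbour of a pair is not a lone neighbour of it. Those two pairs are the sets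
  that the edge \<open>{0, 1}\<close> turns into forts.
\<close>

definition tufted_square :: "nat \<Rightarrow> nat pair_pre_digraph" where
  "tufted_square l = graph_on {..<4 * l + 2}
     (\<lambda>x y. (x, y) \<in> {(0, 1), (1, 2), (2, 3), (3, 0)} \<or> (4 \<le> x \<and> y \<in> {x mod 2, x mod 4}))"

lemma edge_in_tufted_square: "1 \<le> l \<Longrightarrow> {0, 1} \<in> undirected_edges (tufted_square l)"
proof -
  assume "1 \<le> l"
  then have "(0, 1) \<in> parcs (tufted_square l)" by (simp add: tufted_square_def)
  then show ?thesis unfolding undirected_edges_def by blast
qed

lemma tuft_arcs:
  assumes "4 \<le> b" and "y < 4"
  shows "(b, y) \<in> parcs (tufted_square l) \<longleftrightarrow> b < 4 * l + 2 \<and> (y = b mod 2 \<or> y = b mod 4)"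
proof -
  have "(b, y) \<notin> {(0, 1), (1, 2), (2, 3), (3, 0)}" "(y, b) \<notin> {(0, 1), (1, 2), (2, 3), (3, 0)}"
    "\<not> 4 \<le> y" "b \<noteq> y" "b < 4 * l + 2 \<Longrightarrow> y < 4 * l + 2"
    using assms by auto
  with assms(1) show ?thesis
    unfolding tufted_square_def parcs_graph_on lessThan_iff insert_iff empty_iff by blast
qed

lemma mod_2_from_mod_4: "(b::nat) mod 4 = r \<Longrightarrow> b mod 2 = r mod 2"
  using mod_mod_cancel[of 2 4 b] by auto

text \<open>
  The outer vertices meet every fort: a nonempty subset \<open>X\<close> of the core has at least \<open>l + 1\<close> lone
  neighbours. If \<open>X\<close> contains \<open>0\<close> or \<open>1\<close>, these are the \<open>l\<close> leaves there and one more vertex.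
  Otherwise \<open>X\<close> is a part of \<open>{2, 3}\<close>, and a group of \<open>l - 1\<close> common neighbours is completed by
  two vertices of the core, which is now the path \<open>0, 3, 2, 1\<close>.
\<close>

lemma leaky_forcing_number_opened_tufted_square_le:
  assumes "1 \<le> l"
  shows "leaky_forcing_number l (delete_edge (tufted_square l) {0, 1}) \<le> 4 * l - 2"
proof -
  let ?H = "delete_edge (tufted_square l) {0, 1}" and ?D = "{4..<4 * l + 2}"
  have "l < card (lone_neighbours ?H X)"
    if X: "X \<subseteq> {..<4 * l + 2}" "?D \<inter> X = {}" "X \<noteq> {}" for X
  proof -
    have sub: "x = 0 \<or> x = 1 \<or> x = 2 \<or> x = 3" if "x \<in> X" for x
    proof -
      have "\<not> 4 \<le> x" using that X(1,2) by fastforce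
      then show ?thesis by linarith
    qed
    have leaves: "progression 4 (4 + r) l \<subseteq> lone_neighbours ?H X" if "r \<in> X" "r < 2" for r
    proof
      fix b assume "b \<in> progression 4 (4 + r) l"
      then have b: "4 \<le> b" "b < 4 * l + 2" "b mod 4 = r" "b mod 2 = r"
        using that(2) mod_2_from_mod_4[of b r] by (auto simp: progression_def)
      have "b \<notin> X" using b(1) sub[of b] by auto
      then show "b \<in> lone_neighbours ?H X"
        using b that sub assms
        by (intro lone_neighboursI[where w = r])
          (auto simp: tufted_square_def doubleton_eq_iff)
    qed
    \<comment> \<open>The condition \<open>r - 2 \<notin> X\<close> excludes the second neighbour of a common neighbour.\<close>
    have links: "progression 4 (4 + r) (l - 1) \<subseteq> lone_neighbours ?H X"
      if "r \<in> X" "r = 2 \<or> r = 3" "r - 2 \<notin> X" for r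
    proof
      fix b assume "b \<in> progression 4 (4 + r) (l - 1)"
      then have b: "4 \<le> b" "b < 4 * l + 2" "b mod 4 = r" "b mod 2 = r - 2"
        using that(2) mod_2_from_mod_4[of b r] by (auto simp: progression_def)
      have "b \<notin> X" using b(1) sub[of b] by auto
      then show "b \<in> lone_neighbours ?H X"
        using b that sub assms
        by (intro lone_neighboursI[where w = r])
          (auto simp: tufted_square_def doubleton_eq_iff)
    qed
    have core: "(b, x) \<in> parcs ?H \<longleftrightarrow>
        (b, x) \<in> {(0, 3), (3, 0), (1, 2), (2, 1), (2, 3), (3, 2)}" if "b < 4" "x \<in> X" for b x
    proof -
      have "b = 0 \<or> b = 1 \<or> b = 2 \<or> b = 3" using that(1) by linarith
      then show ?thesis
        using sub[OF that(2)] assms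
        by (elim disjE) (simp_all add: tufted_square_def doubleton_eq_iff)
    qed
    have coreI: "b \<in> lone_neighbours ?H X"
      if b: "b < 4" "b \<notin> X" "w \<in> X" "(b, w) \<in> {(0, 3), (3, 0), (1, 2), (2, 1), (2, 3), (3, 2)}"
        and uniq: "\<And>x. x \<in> X \<Longrightarrow> (b, x) \<in> {(0, 3), (3, 0), (1, 2), (2, 1), (2, 3), (3, 2)} \<Longrightarrow> x = w"
      for b w
    proof (rule lone_neighboursI)
      show "b \<in> pverts ?H" using b(1) assms by (simp add: tufted_square_def)
      show "b \<notin> X" "w \<in> X" using b by auto
      show "(b, w) \<in> parcs ?H" using core[OF b(1,3)] b(4) by blast
      show "x = w" if "x \<in> X" "(b, x) \<in> parcs ?H" for x
        using core[OF b(1) that(1)] that by (intro uniq) blast+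
    qed
    have end0: "0 \<in> lone_neighbours ?H X" if "0 \<notin> X" "3 \<in> X"
      using that by (intro coreI[where w = 3]) auto
    have end1: "1 \<in> lone_neighbours ?H X" if "1 \<notin> X" "2 \<in> X"
      using that by (intro coreI[where w = 2]) auto
    have inner2: "2 \<in> lone_neighbours ?H X" if "2 \<notin> X" "1 \<in> X \<longleftrightarrow> 3 \<notin> X"
      using that by (intro coreI[where w = "if 1 \<in> X then 1 else 3"]) (auto split: if_splits)
    have inner3: "3 \<in> lone_neighbours ?H X" if "3 \<notin> X" "0 \<in> X \<longleftrightarrow> 2 \<notin> X"
      using that by (intro coreI[where w = "if 0 \<in> X then 0 else 2"]) (auto split: if_splits)
    have enough: "l < card (lone_neighbours ?H X)"
      if "progression 4 c m \<subseteq> lone_neighbours ?H X" "Y \<subseteq> lone_neighbours ?H X"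
        "finite Y" "progression 4 c m \<inter> Y = {}" "l < m + card Y" for c m Y
      using that
      by (intro less_card_lone_neighboursI[where F = "progression 4 c m \<union> Y"])
        (auto simp: tufted_square_def card_Un_disjoint card_progression finite_progression)
    consider "0 \<in> X" "1 \<in> X" | "0 \<in> X" "1 \<notin> X" | "0 \<notin> X" "1 \<in> X"
      | "0 \<notin> X" "1 \<notin> X" "2 \<in> X" | "0 \<notin> X" "1 \<notin> X" "2 \<notin> X" "3 \<in> X"
      using X(3) sub by blast
    then show ?thesis
    proof cases
      case 1
      show ?thesis
        by (rule enough[OF leaves[of 0] leaves[of 1]])
          (use 1 assms in \<open>auto simp: progression_iff card_progression finite_progression\<close>)
    next
      case 2
      then have "{1, 2, 3} \<inter> lone_neighbours ?H X \<noteq> {}"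
        using end1 inner2 inner3 by (cases "2 \<in> X"; cases "3 \<in> X") auto
      then obtain y where "y \<in> {1, 2, 3}" "y \<in> lone_neighbours ?H X" by blast
      then show ?thesis
        by (intro enough[OF leaves[of 0], of "{y}"]) (use 2 in \<open>auto simp: progression_iff\<close>)
    next
      case 3
      then have "{0, 2, 3} \<inter> lone_neighbours ?H X \<noteq> {}"
        using end0 inner2 inner3 by (cases "2 \<in> X"; cases "3 \<in> X") auto
      then obtain y where "y \<in> {0, 2, 3}" "y \<in> lone_neighbours ?H X" by blast
      then show ?thesis
        by (intro enough[OF leaves[of 1], of "{y}"]) (use 3 in \<open>auto simp: progression_iff\<close>)
    next
      case 4
      then have "(if 3 \<in> X then 0 else 3) \<in> lone_neighbours ?H X" "1 \<in> lone_neighbours ?H X"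
        using end0 end1 inner3 by auto
      then show ?thesis
        by (intro enough[OF links[of 2], of "{if 3 \<in> X then 0 else 3, 1}"])
          (use 4 in \<open>auto simp: progression_iff\<close>)
    next
      case 5
      then show ?thesis
        using end0 inner2
        by (intro enough[OF links[of 3], of "{0, 2}"]) (auto simp: progression_iff)
    qed
  qed
  then have "leaky_forcing_set l ?H ?D"
    by (subst leaky_forcing_set_iff_meets_forts) (auto simp: tufted_square_def not_le[symmetric])
  from leaky_forcing_number_le[OF this] show ?thesis by simp
qed

text \<open>
  Besides the \<open>4 * l - 2\<close> outer vertices a forcing set contains an element of each of the disjoint
  forts \<open>{0, 2}\<close> and \<open>{1, 3}\<close>. Opposite corners of the square have the same neighbours except for
  the leaves at one of them, so these \<open>l\<close> leaves are the only lone neighbours of the pair.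
\<close>

lemma leaky_forcing_number_tufted_square_ge:
  assumes "1 \<le> l"
  shows "4 * l \<le> leaky_forcing_number l (tufted_square l)"
proof -
  let ?G = "tufted_square l" and ?D = "{4..<4 * l + 2}"
  have graph: "pair_graph ?G"
    unfolding tufted_square_def by (intro pair_graph_graph_on) simp
  interpret pair_graph ?G by (rule graph)
  obtain S where S: "leaky_forcing_set l ?G S" "card S = leaky_forcing_number l ?G"
    using leaky_forcing_number_attained by blast
  have tufts: "v \<in> S" if v: "v \<in> ?D" for v
  proof (rule low_degree_in_leaky_forcing_set[OF graph S(1)])
    show "v \<in> pverts ?G" using v by (simp add: tufted_square_def)
    show "{b. (b, v) \<in> parcs ?G} \<subseteq> {v mod 2, v mod 4}"
      using v by (auto simp: tufted_square_def)
    \<comment> \<open>For \<open>l = 1\<close> only the leaves \<open>4\<close> and \<open>5\<close> exist, whose two residues coincide.\<close>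
    show "card {v mod 2, v mod 4} \<le> l"
    proof (cases "l = 1")
      case True
      then have "v = 4 \<or> v = 5" using v by auto
      then show ?thesis using True by auto
    next
      case False
      then show ?thesis using assms by (simp add: card_insert_if)
    qed
  qed simp
  have meets: "S \<inter> {r, r + 2} \<noteq> {}" if r: "r < 2" for r
  proof -
    have "lone_neighbours ?G {r, r + 2} \<subseteq> progression 4 (4 + r) l"
    proof
      fix b assume b: "b \<in> lone_neighbours ?G {r, r + 2}"
      show "b \<in> progression 4 (4 + r) l"
      proof (rule ccontr)
        assume "b \<notin> progression 4 (4 + r) l"
        have bV: "b < 4 * l + 2" "b \<noteq> r" "b \<noteq> r + 2"
          using b by (auto simp: lone_neighbours_def tufted_square_def)
        have tuft: "b mod 4 \<noteq> r" if "4 \<le> b"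
        proof
          assume "b mod 4 = r"
          then obtain q where q: "b = 4 * q + r" by (metis mult_div_mod_eq)
          then have "b = 4 + r + 4 * (q - 1)" "q - 1 < l" using that r bV(1) by arith+
          then have "b \<in> progression 4 (4 + r) l" unfolding progression_def by blast
          then show False using \<open>b \<notin> progression 4 (4 + r) l\<close> by contradiction
        qed
        \<comment> \<open>Away from the leaves at \<open>r\<close> the corners \<open>r\<close> and \<open>r + 2\<close> are twins.\<close>
        have "(b, r) \<in> parcs ?G \<longleftrightarrow> (b, r + 2) \<in> parcs ?G"
        proof (cases "4 \<le> b")
          case True
          have "(b, r) \<in> parcs ?G \<longleftrightarrow> r = b mod 2"
            using tuft[OF True] bV(1) r tuft_arcs[OF True, of r l] by auto
          moreover have "(b, r + 2) \<in> parcs ?G \<longleftrightarrow> r + 2 = b mod 4"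
            using bV(1) r tuft_arcs[OF True, of "r + 2" l] by auto
          ultimately show ?thesis using tuft[OF True] r by presburger
        next
          case False
          then have "b = 0 \<or> b = 1 \<or> b = 2 \<or> b = 3" by linarith
          moreover have "r = 0 \<or> r = 1" using r by linarith
          ultimately show ?thesis
            using bV assms by (elim disjE) (simp_all add: tufted_square_def)
        qed
        moreover from b obtain w where "w \<in> {r, r + 2}" "(b, w) \<in> parcs ?G"
          and uniq: "\<And>x. x \<in> {r, r + 2} \<Longrightarrow> (b, x) \<in> parcs ?G \<Longrightarrow> x = w"
          unfolding lone_neighbours_def by blast
        ultimately have "r = w" "r + 2 = w" by blast+
        then show False by simp
      qed
    qed
    then have "card (lone_neighbours ?G {r, r + 2}) \<le> l"
      by (metis card_mono card_progression finite_progression zero_less_numeral)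
    moreover have "{r, r + 2} \<subseteq> pverts ?G" using r assms by (auto simp: tufted_square_def)
    ultimately show ?thesis
      using S(1) leaky_forcing_set_iff_meets_forts[OF pair_finite_verts, of l S] by blast
  qed
  from meets[of 0] obtain x where x: "x \<in> S" "x = 0 \<or> x = 2" by auto
  from meets[of 1] obtain y where y: "y \<in> S" "y = 1 \<or> y = 3" by (auto simp: numeral_eq_Suc)
  have "finite S"
    using S(1) by (auto simp: leaky_forcing_set_def tufted_square_def intro: finite_subset)
  then have "card (insert x (insert y ?D)) \<le> card S"
    using x y tufts by (intro card_mono) auto
  moreover have "card (insert x (insert y ?D)) = 4 * l"
    using x y assms by (auto simp: card_insert_if)
  ultimately show ?thesis using S(2) by simp
qed

theorem theorem5p2:
  shows "(\<forall>(G :: 'a pair_pre_digraph) (l :: nat) e.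
            pair_graph G \<and> e \<in> undirected_edges G \<longrightarrow>
              - 2 \<le> int (leaky_forcing_number l G) - int (leaky_forcing_number l (delete_edge G e)) \<and>
              int (leaky_forcing_number l G) - int (leaky_forcing_number l (delete_edge G e)) \<le> 2)
       \<and> (\<forall>l :: nat. 1 \<le> l \<longrightarrow>
            (\<exists>(G :: nat pair_pre_digraph) e.
              pair_graph G \<and> e \<in> undirected_edges G \<and>
              int (leaky_forcing_number l G) - int (leaky_forcing_number l (delete_edge G e)) = - 2) \<and>
            (\<exists>(G :: nat pair_pre_digraph) e.
              pair_graph G \<and> e \<in> undirected_edges G \<and>
              int (leaky_forcing_number l G) - int (leaky_forcing_number l (delete_edge G e)) = 2))"
proof (intro conjI allI impI, goal_cases)
  case (1 G l e)
  then show ?case using leaky_forcing_number_delete_edge(1)[of G e l] by linarith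
next
  case (2 G l e)
  then show ?case using leaky_forcing_number_delete_edge(2)[of G e l] by linarith
next
  case (3 l)
  have graph: "pair_graph (double_star l)"
    unfolding double_star_def by (simp add: pair_graph_graph_on)
  show ?case
    using graph edge_in_double_star leaky_forcing_number_double_star_le[OF 3]
      leaky_forcing_number_split_double_star_ge[OF 3]
      leaky_forcing_number_delete_edge(1)[OF graph edge_in_double_star, of l]
    by (intro exI[of _ "double_star l"] exI[of _ "{0, 1}"]) simp
next
  case (4 l)
  have graph: "pair_graph (tufted_square l)"
    unfolding tufted_square_def by (simp add: pair_graph_graph_on)
  show ?case
    using 4 graph edge_in_tufted_square[OF 4] leaky_forcing_number_tufted_square_ge[OF 4]
      leaky_forcing_number_opened_tufted_square_le[OF 4]
      leaky_forcing_number_delete_edge(2)[OF graph edge_in_tufted_square[OF 4], of l]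
    by (intro exI[of _ "tufted_square l"] exI[of _ "{0, 1}"]) auto
qed

end
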